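(* For every integer $n\ge 3$, $\operatorname{osat}_{\mathcal C}(n)=2n-4$.
   Context: A finite set of points in the plane is in general position if no three of its points are collinear. A set of $n$ points is a convex $n$-set if the points are in convex position. $\operatorname{osat}_{\mathcal C}(n)$ is the minimum size of a finite point set $S$ in the plane in general position such that for every point $P\notin S$ with $S\cup\{P\}$ in general position, $S\cup\{P\}$ contains a convex $n$-set containing $P$ (i.e. a new convex $n$-set). *)

theory Defs
  imports "HOL-Analysis.Analysis"
begin

definition general_position :: "(real ^ 2) set \<Rightarrow> bool" where
  "general_position S \<longleftrightarrow> (\<forall>T\<subseteq>S. card T = 3 \<longrightarrow> \<not> collinear T)"

definition convex_position :: "(real ^ 2) set \<Rightarrow> bool" where
  "convex_position T \<longleftrightarrow> (\<forall>p\<in>T. p \<notin> convex hull (T - {p}))"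

definition convex_nset :: "nat \<Rightarrow> (real ^ 2) set \<Rightarrow> bool" where
  "convex_nset n T \<longleftrightarrow> finite T \<and> card T = n \<and> convex_position T"

text \<open>
  The set \<open>S\<close> itself is allowed to contain convex \<open>n\<close>-sets; what is required is that every
  admissible new point creates one through that point.
\<close>

definition osaturated :: "nat \<Rightarrow> (real ^ 2) set \<Rightarrow> bool" where
  "osaturated n S \<longleftrightarrow>
     finite S \<and> general_position S \<and>
     (\<forall>P. P \<notin> S \<and> general_position (S \<union> {P}) \<longrightarrow>
        (\<exists>T\<subseteq>S \<union> {P}. P \<in> T \<and> convex_nset n T))"

text \<open>
  On \<^typ>\<open>nat\<close>, \<^const>\<open>Inf\<close> of a nonempty set is its minimum and \<^const>\<open>Inf\<close> of the empty set is
  \<open>0\<close>; hence a nonzero value is attained by some saturated set.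
\<close>

definition osat :: "nat \<Rightarrow> nat" where
  "osat n = Inf {card S | S. osaturated n S}"

end

theory Submission
  imports Defs
begin

text \<open>
  Lower bound: fix a direction \<open>u\<close> parallel to no line spanned by \<open>S\<close> and add a point \<open>P\<close> very
  far away in direction \<open>u\<close>, or \<open>P'\<close> very far away in direction \<open>-u\<close>. A convex set through \<open>P\<close>
  meets \<open>S\<close> in a cup, one through \<open>P'\<close> in a cap, and a cup and a cap share at most two points.
  If both contain \<open>n - 1\<close> points of \<open>S\<close>, then \<open>S\<close> has at least \<open>2 (n - 1) - 2\<close> points.

  Upper bound: take \<open>n - 2\<close> antipodal pairs on the unit circle. If the new point \<open>P\<close> lies in the
  closed disc, the closed half-plane that avoids \<open>P\<close> and is bounded by the line through an antipodal
  pair contains that pair and a point of each other pair. If \<open>P\<close> lies outside the disc, take the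
  points that stay extreme after adding \<open>P\<close>: of each pair at least one does, and a pair at
  maximal distance from the line through \<open>P\<close> and the centre survives entirely.
\<close>

section \<open>Orientation of triples and general position\<close>

definition cross2 :: "real ^ 2 \<Rightarrow> real ^ 2 \<Rightarrow> real" where
  "cross2 a b = a $ 1 * b $ 2 - a $ 2 * b $ 1"

text \<open>Twice the signed area of the triangle, positive for counterclockwise order.\<close>

definition orient :: "real ^ 2 \<Rightarrow> real ^ 2 \<Rightarrow> real ^ 2 \<Rightarrow> real" where
  "orient a b c = cross2 (b - a) (c - a)"

lemma linear_cross2: "linear (cross2 a)"
  by (rule linearI) (auto simp: cross2_def algebra_simps)

lemma collinear_iff_orient: "collinear {a, b, c} \<longleftrightarrow> orient a b c = 0"
proof (cases "a = b")
  case True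
  then show ?thesis
    by (simp add: orient_def cross2_def)
next
  case False
  have "collinear {a, b, c} \<longleftrightarrow> collinear {0, b - a, c - a}"
    using collinear_3[of b a c] by (simp add: insert_commute)
  also have "\<dots> \<longleftrightarrow> (\<exists>k. c - a = k *\<^sub>R (b - a))"
    using False by (auto simp: collinear_lemma)
  also have "\<dots> \<longleftrightarrow> orient a b c = 0"
  proof
    assume "orient a b c = 0"
    then have "(b - a) $ 1 * (c - a) $ 2 = (b - a) $ 2 * (c - a) $ 1"
      by (simp add: orient_def cross2_def)
    moreover have "b - a \<noteq> 0"
      using False by simp
    moreover have "\<exists>k. q = k *\<^sub>R p" if "p $ 1 * q $ 2 = p $ 2 * q $ 1" "p \<noteq> 0" for p q :: "real ^ 2"
    proof (cases "p $ 1 = 0")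
      case True
      with that have "p $ 2 \<noteq> 0" "q $ 1 = 0"
        by (auto simp: vec_eq_iff forall_2)
      with True show ?thesis
        by (intro exI[of _ "q $ 2 / p $ 2"]) (simp add: vec_eq_iff forall_2)
    next
      case False
      with that show ?thesis
        by (intro exI[of _ "q $ 1 / p $ 1"]) (simp add: vec_eq_iff forall_2 field_simps)
    qed
    ultimately show "\<exists>k. c - a = k *\<^sub>R (b - a)"
      by blast
  next
    assume "\<exists>k. c - a = k *\<^sub>R (b - a)"
    then obtain k where "c - a = k *\<^sub>R (b - a)" ..
    then show "orient a b c = 0"
      by (simp only: orient_def cross2_def vector_scaleR_component real_scaleR_def) simp
  qed
  finally show ?thesis .
qed

lemma general_position_iff:
  "general_position S \<longleftrightarrow>
     (\<forall>a\<in>S. \<forall>b\<in>S. \<forall>c\<in>S. a \<noteq> b \<and> a \<noteq> c \<and> b \<noteq> c \<longrightarrow> orient a b c \<noteq> 0)"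
proof (intro iffI ballI impI)
  fix a b c assume "general_position S" "a \<in> S" "b \<in> S" "c \<in> S" "a \<noteq> b \<and> a \<noteq> c \<and> b \<noteq> c"
  moreover from this have "{a, b, c} \<subseteq> S" "card {a, b, c} = 3" by auto
  ultimately show "orient a b c \<noteq> 0"
    unfolding general_position_def collinear_iff_orient[symmetric] by blast
next
  assume R: "\<forall>a\<in>S. \<forall>b\<in>S. \<forall>c\<in>S. a \<noteq> b \<and> a \<noteq> c \<and> b \<noteq> c \<longrightarrow> orient a b c \<noteq> 0"
  show "general_position S"
    unfolding general_position_def
  proof (intro allI impI)
    fix T assume "T \<subseteq> S" "card T = 3"
    then obtain a b c where "T = {a, b, c}" "a \<noteq> b" "a \<noteq> c" "b \<noteq> c"
      unfolding card_3_iff by blast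
    with R \<open>T \<subseteq> S\<close> show "\<not> collinear T"
      by (simp add: collinear_iff_orient)
  qed
qed

lemma orient_rotate: "orient b c a = orient a b c"
  and orient_swap: "orient b a c = - orient a b c"
  by (simp_all add: orient_def cross2_def algebra_simps)

lemma general_position_insert:
  assumes "general_position S"
    and "\<And>a b. a \<in> S \<Longrightarrow> b \<in> S \<Longrightarrow> a \<noteq> b \<Longrightarrow> orient a b P \<noteq> 0"
  shows "general_position (S \<union> {P})"
  using assms orient_rotate unfolding general_position_iff by auto metis+

text \<open>The three orientations are, up to the common factor \<open>D = orient x z P\<close>, the
  barycentric coordinates of \<open>y\<close> in the triangle \<open>x\<close>, \<open>z\<close>,
  \<open>P\<close>. The factor \<open>s\<close> treats both signs of the orientation at
  once.\<close>

lemma mem_triangle_if_orient_same_sign: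
  assumes "0 < s * orient x z y" "0 < s * orient y z P" "0 < s * orient x y P"
  shows "y \<in> convex hull {x, z, P}"
proof -
  define D where "D = orient y z P + orient x y P + orient x z y"
  have sD: "s * D > 0"
    using assms unfolding D_def by (simp add: distrib_left)
  then have "s \<noteq> 0" "D \<noteq> 0" by auto
  have frac: "0 \<le> r / D" if "0 < s * r" for r
    using that sD by (auto simp: zero_less_mult_iff intro: divide_nonneg_nonneg divide_nonpos_nonpos)
  have "D *\<^sub>R y = orient y z P *\<^sub>R x + orient x y P *\<^sub>R z + orient x z y *\<^sub>R P"
    by (simp add: D_def orient_def cross2_def vec_eq_iff forall_2) algebra
  then have "inverse D *\<^sub>R (D *\<^sub>R y) =
      inverse D *\<^sub>R (orient y z P *\<^sub>R x + orient x y P *\<^sub>R z + orient x z y *\<^sub>R P)"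
    by simp
  then have "y = (orient y z P / D) *\<^sub>R x + (orient x y P / D) *\<^sub>R z + (orient x z y / D) *\<^sub>R P"
    using \<open>D \<noteq> 0\<close> by (simp add: scaleR_add_right divide_inverse mult.commute)
  moreover have "orient y z P / D + orient x y P / D + orient x z y / D = 1"
    using \<open>D \<noteq> 0\<close> by (simp add: D_def flip: add_divide_distrib)
  ultimately show ?thesis
    unfolding convex_hull_3 using frac assms by blast
qed

section \<open>Lower bound: far points in a generic direction\<close>

lemma exists_generic_direction:
  assumes "finite S"
  obtains u where "\<And>a b. a \<in> S \<Longrightarrow> b \<in> S \<Longrightarrow> a \<noteq> b \<Longrightarrow> cross2 a u \<noteq> cross2 b u"
proof -
  \<comment> \<open>For \<open>u = vector [1, t]\<close>, equality of \<open>cross2 a u\<close> and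
    \<open>cross2 b u\<close> says that \<open>b - a\<close> is parallel to \<open>u\<close>.
    Division by zero gives vertical pairs the slope \<open>0\<close>; this is harmless, as
    \<open>u\<close> is never vertical.\<close>
  let ?slopes = "(\<lambda>(a, b). (b $ 2 - a $ 2) / (b $ 1 - a $ 1)) ` (S \<times> S)"
  have "finite ?slopes"
    using assms by simp
  then obtain t where t: "t \<notin> ?slopes"
    using ex_new_if_finite infinite_UNIV_char_0 by blast
  have "cross2 a (vector [1, t]) \<noteq> cross2 b (vector [1, t])" if "a \<in> S" "b \<in> S" "a \<noteq> b" for a b
  proof
    assume "cross2 a (vector [1, t]) = cross2 b (vector [1, t])"
    then have eq: "b $ 2 - a $ 2 = t * (b $ 1 - a $ 1)"
      by (simp add: cross2_def vector_2 algebra_simps)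
    with \<open>a \<noteq> b\<close> have "b $ 1 - a $ 1 \<noteq> 0"
      by (auto simp: vec_eq_iff forall_2)
    with eq have "t = (b $ 2 - a $ 2) / (b $ 1 - a $ 1)"
      by simp
    with t that show False by force
  qed
  then show ?thesis by (rule that)
qed

text \<open>Seen from \<open>(s * M) *\<^sub>R u\<close>, the orientation of \<open>a\<close>,
  \<open>b\<close> is \<open>cross2 a b\<close> plus a term linear in \<open>M\<close>. For large
  \<open>M\<close> that term dominates, so the sign depends only on \<open>s\<close> and on the
  order of \<open>a\<close> and \<open>b\<close> under \<open>cross2 _ u\<close>.\<close>

lemma exists_far_distance:
  assumes "finite S" "\<And>a b. a \<in> S \<Longrightarrow> b \<in> S \<Longrightarrow> a \<noteq> b \<Longrightarrow> cross2 a u \<noteq> cross2 b u"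
    and "u \<noteq> 0"
  obtains M where "\<And>s. \<bar>s\<bar> = 1 \<Longrightarrow> (s * M) *\<^sub>R u \<notin> S"
    and "\<And>s a b. \<bar>s\<bar> = 1 \<Longrightarrow> a \<in> S \<Longrightarrow> b \<in> S \<Longrightarrow> cross2 a u < cross2 b u \<Longrightarrow>
           0 < s * orient a b ((s * M) *\<^sub>R u)"
proof -
  have large: "\<forall>\<^sub>F M in at_top. r < M * c" if "c > 0" for r c :: real
    using eventually_gt_at_top[of "r / c"] by eventually_elim (use that in \<open>simp add: field_simps\<close>)
  have "\<forall>\<^sub>F M in at_top. \<forall>a\<in>S. norm a < M * norm u"
    using assms by (intro eventually_ball_finite ballI large) auto
  moreover have "\<forall>\<^sub>F M in at_top. \<forall>a\<in>S. \<forall>b\<in>S. a \<noteq> b \<longrightarrow>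
      \<bar>cross2 a b\<bar> < M * \<bar>cross2 b u - cross2 a u\<bar>"
    using assms by (intro eventually_ball_finite ballI) (auto intro!: large)
  moreover have "\<forall>\<^sub>F M in at_top. (0::real) < M"
    by (rule eventually_gt_at_top)
  ultimately have "\<forall>\<^sub>F M in at_top. 0 < M \<and> (\<forall>a\<in>S. norm a < M * norm u) \<and>
      (\<forall>a\<in>S. \<forall>b\<in>S. a \<noteq> b \<longrightarrow> \<bar>cross2 a b\<bar> < M * \<bar>cross2 b u - cross2 a u\<bar>)"
    by eventually_elim auto
  then obtain M :: real where M: "0 < M" "\<And>a. a \<in> S \<Longrightarrow> norm a < M * norm u"
      "\<And>a b. a \<in> S \<Longrightarrow> b \<in> S \<Longrightarrow> a \<noteq> b \<Longrightarrow> \<bar>cross2 a b\<bar> < M * \<bar>cross2 b u - cross2 a u\<bar>"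
    by (auto dest: eventually_happens'[OF trivial_limit_at_top_linorder])
  show ?thesis
  proof
    show "(s * M) *\<^sub>R u \<notin> S" if "\<bar>s\<bar> = 1" for s
      using M(1) M(2)[of "(s * M) *\<^sub>R u"] that by (auto simp: abs_mult)
  next
    fix s :: real and a b
    assume s: "\<bar>s\<bar> = 1" and ab: "a \<in> S" "b \<in> S" "cross2 a u < cross2 b u"
    then have less: "\<bar>cross2 a b\<bar> < M * (cross2 b u - cross2 a u)"
      using M(3)[of a b] by auto
    have "orient a b ((s * M) *\<^sub>R u) = cross2 a b + s * (M * (cross2 b u - cross2 a u))"
      by (simp add: orient_def cross2_def algebra_simps)
    with less s show "0 < s * orient a b ((s * M) *\<^sub>R u)"
      by (cases "s = 1") (auto simp: abs_if split: if_splits)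
  qed
qed

lemma card_ge_3_sorted:
  fixes h :: "'a \<Rightarrow> real"
  assumes "inj_on h C" "3 \<le> card C"
  obtains x y z where "x \<in> C" "y \<in> C" "z \<in> C" "h x < h y" "h y < h z"
proof -
  obtain D where "D \<subseteq> C" "card D = 3"
    using assms(2) by (meson obtain_subset_with_card_n)
  then obtain x y z where "x \<in> C" "y \<in> C" "z \<in> C" "x \<noteq> y" "x \<noteq> z" "y \<noteq> z"
    by (auto simp: card_3_iff)
  moreover from this have "h x \<noteq> h y" "h x \<noteq> h z" "h y \<noteq> h z"
    using assms(1) by (auto dest: inj_onD)
  ultimately show ?thesis
    using that by (metis linorder_neqE)
qed

lemma osaturated_card_ge:
  assumes sat: "osaturated n S"
  shows "2 * n - 4 \<le> card S"
proof (rule ccontr)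
  assume "\<not> 2 * n - 4 \<le> card S"
  then have small: "card S < 2 * n - 4" by simp
  have "finite S" and gp: "general_position S"
    using sat by (auto simp: osaturated_def)
  obtain u0 where u0: "\<And>a b. a \<in> S \<Longrightarrow> b \<in> S \<Longrightarrow> a \<noteq> b \<Longrightarrow> cross2 a u0 \<noteq> cross2 b u0"
    using exists_generic_direction[OF \<open>finite S\<close>] by blast
  \<comment> \<open>The vector \<open>u0\<close> can be zero only if \<open>S\<close> has at most
    one point; then any nonzero vector is generic.\<close>
  obtain u where u: "u \<noteq> 0" "\<And>a b. a \<in> S \<Longrightarrow> b \<in> S \<Longrightarrow> a \<noteq> b \<Longrightarrow> cross2 a u \<noteq> cross2 b u"
  proof (cases "u0 = 0")
    case True
    then have "a = b" if "a \<in> S" "b \<in> S" for a b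
      using u0[of a b] that by (auto simp: cross2_def)
    then show ?thesis
      using that[of "axis 1 1"] by (auto simp: axis_eq_0_iff)
  qed (use u0 that in blast)
  obtain M where M: "\<And>s. \<bar>s\<bar> = 1 \<Longrightarrow> (s * M) *\<^sub>R u \<notin> S"
    "\<And>s a b. \<bar>s\<bar> = 1 \<Longrightarrow> a \<in> S \<Longrightarrow> b \<in> S \<Longrightarrow> cross2 a u < cross2 b u \<Longrightarrow>
       0 < s * orient a b ((s * M) *\<^sub>R u)"
    using exists_far_distance[OF \<open>finite S\<close> u(2,1)] by blast
  \<comment> \<open>\<open>P 1\<close> and \<open>P (-1)\<close> are the two far points, in opposite
    directions.\<close>
  define P where "P s = (s * M) *\<^sub>R u" for s
  have "\<exists>T. T \<subseteq> S \<union> {P s} \<and> P s \<in> T \<and> convex_nset n T" if "\<bar>s\<bar> = 1" for s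
  proof -
    have "orient a b (P s) \<noteq> 0" if "a \<in> S" "b \<in> S" "a \<noteq> b" for a b
      using M(2)[OF \<open>\<bar>s\<bar> = 1\<close>, of a b] M(2)[OF \<open>\<bar>s\<bar> = 1\<close>, of b a] u(2)[OF that] that
        orient_swap[of a b "P s"]
      by (fastforce simp: P_def neq_iff)
    then have "general_position (S \<union> {P s})"
      by (intro general_position_insert gp)
    then show ?thesis
      using sat M(1)[OF that] unfolding osaturated_def P_def by blast
  qed
  then obtain T where T: "\<And>s. \<bar>s\<bar> = 1 \<Longrightarrow> T s \<subseteq> S \<union> {P s} \<and> P s \<in> T s \<and> convex_nset n (T s)"
    by metis
  define Q where "Q s = T s - {P s}" for s
  have Q: "Q s \<subseteq> S" "card (Q s) = n - 1" if "\<bar>s\<bar> = 1" for s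
    using T[OF that] by (auto simp: Q_def convex_nset_def)
  have "card (Q 1) + card (Q (-1)) = card (Q 1 \<union> Q (-1)) + card (Q 1 \<inter> Q (-1))"
    using Q(1)[of 1] Q(1)[of "-1"] \<open>finite S\<close> by (intro card_Un_Int) (auto intro: finite_subset)
  moreover have "card (Q 1 \<union> Q (-1)) \<le> card S"
    using Q \<open>finite S\<close> by (intro card_mono) auto
  \<comment> \<open>The assumption \<open>small\<close> forces \<open>n >= 3\<close>, so the
    truncated subtractions are exact: \<open>2 * (n - 1)\<close> points counted with multiplicity,
    in a union of at most \<open>2 * n - 5\<close>, leave three in common.\<close>
  ultimately have "3 \<le> card (Q 1 \<inter> Q (-1))"
    using small Q(2) by simp
  moreover have "inj_on (\<lambda>a. cross2 a u) (Q 1 \<inter> Q (-1))"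
    using Q(1)[of 1] u(2) by (auto simp: inj_on_def)
  ultimately obtain x y z where xyz: "x \<in> Q 1 \<inter> Q (-1)" "y \<in> Q 1 \<inter> Q (-1)" "z \<in> Q 1 \<inter> Q (-1)"
    "cross2 x u < cross2 y u" "cross2 y u < cross2 z u"
    using card_ge_3_sorted by blast
  have S: "x \<in> S" "y \<in> S" "z \<in> S"
    using xyz Q(1)[of 1] by auto
  have neq: "x \<noteq> y" "x \<noteq> z" "y \<noteq> z"
    using xyz by auto
  \<comment> \<open>The turn at the middle point \<open>y\<close> selects the far point for which
    \<open>y\<close> falls inside the triangle spanned by \<open>x\<close>, \<open>z\<close> and
    that point.\<close>
  define s where "s = sgn (orient x z y)"
  have "orient x z y \<noteq> 0"
    using gp S neq by (auto simp: general_position_iff)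
  then have s: "\<bar>s\<bar> = 1" "s = 1 \<or> s = -1" "0 < s * orient x z y"
    by (auto simp: s_def sgn_if)
  have "y \<in> convex hull {x, z, P s}"
    using s M(2)[OF s(1)] S xyz unfolding P_def
    by (intro mem_triangle_if_orient_same_sign) auto
  moreover have "{x, z, P s} \<subseteq> T s - {y}"
    using xyz s(2) neq T[OF s(1)] by (auto simp: Q_def)
  ultimately have "y \<in> convex hull (T s - {y})"
    using hull_mono by blast
  moreover have "y \<in> T s"
    using xyz s(2) by (auto simp: Q_def)
  ultimately show False
    using T[OF s(1)] by (auto simp: convex_nset_def convex_position_def)
qed

section \<open>Supporting lines and the unit circle\<close>

lemma not_mem_hull_if_strict_support:
  fixes v :: "'a::real_inner"
  assumes "\<And>x. x \<in> X \<Longrightarrow> v \<bullet> x < c" "c \<le> v \<bullet> y"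
  shows "y \<notin> convex hull X"
proof -
  have "convex hull X \<subseteq> {x. v \<bullet> x < c}"
    using assms by (intro hull_minimal) (auto simp: convex_halfspace_lt)
  with assms show ?thesis by auto
qed

text \<open>The hyperplane tangent at \<open>v\<close> meets the closed unit ball only in
  \<open>v\<close>: expand the positive square of \<open>norm (v - x)\<close>.\<close>

lemma inner_unit_less_1:
  fixes v x :: "'a::real_inner"
  assumes "norm v = 1" "norm x \<le> 1" "x \<noteq> v"
  shows "v \<bullet> x < 1"
proof -
  have "0 < (norm (v - x))\<^sup>2"
    using assms by simp
  also have "\<dots> = 1 - 2 * (v \<bullet> x) + (norm x)\<^sup>2"
    using assms by (simp add: power2_norm_eq_inner norm_eq_1 inner_diff inner_commute)
  also have "(norm x)\<^sup>2 \<le> 1"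
    using assms by (simp add: power_le_one)
  finally show ?thesis by simp
qed

lemma unit_not_mem_hull:
  fixes v :: "'a::real_inner"
  assumes "norm v = 1" "\<And>x. x \<in> X \<Longrightarrow> norm x = 1" "v \<notin> X"
  shows "v \<notin> convex hull X"
proof (rule not_mem_hull_if_strict_support)
  show "v \<bullet> x < 1" if "x \<in> X" for x
    using assms that by (intro inner_unit_less_1) auto
  show "1 \<le> v \<bullet> v"
    using assms by (simp add: norm_eq_1)
qed

text \<open>Of three collinear points one lies on the segment between the other two, which
  \<open>unit_not_mem_hull\<close> excludes for distinct unit vectors.\<close>

lemma general_position_unit_circle:
  assumes "\<And>v. v \<in> S \<Longrightarrow> norm v = 1"
  shows "general_position S"
proof -
  have "\<not> collinear {a, b, c}" if "a \<in> S" "b \<in> S" "c \<in> S" "a \<noteq> b" "a \<noteq> c" "b \<noteq> c" for a b c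
    using unit_not_mem_hull[of a "{b, c}"] unit_not_mem_hull[of b "{c, a}"]
      unit_not_mem_hull[of c "{a, b}"] assms that
    by (auto simp: collinear_between_cases between_mem_segment segment_convex_hull)
  then show ?thesis
    by (auto simp: general_position_iff collinear_iff_orient)
qed

section \<open>Antipodal sets and their extension by one point\<close>

lemma eq_uminus_iff_eq_0: "v = - v \<longleftrightarrow> v = 0" for v :: "'a::real_vector"
  by (metis add.right_inverse scaleR_2 scaleR_eq_0_iff neg_0_equal_iff_equal zero_neq_numeral)

text \<open>Inclusion-exclusion for \<open>R\<close> and its reflection: the union covers
  \<open>S\<close>, and the intersection contains \<open>v0\<close> and \<open>- v0\<close>, so
  \<open>2 * card R >= 2 * k + 2\<close>. The complete pair supplies the extra point.\<close>

lemma card_gt_half_if_meets_antipodal_pairs: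
  fixes S :: "'a::real_vector set"
  assumes "finite S" "R \<subseteq> S" "card S = 2 * k"
    and "\<And>v. v \<in> S \<Longrightarrow> v \<in> R \<or> - v \<in> R"
    and "v0 \<in> R" "- v0 \<in> R" "v0 \<noteq> 0"
  shows "k + 1 \<le> card R"
proof -
  have fin: "finite R"
    using assms finite_subset by blast
  have "S \<subseteq> R \<union> uminus ` R"
    using assms(4) by force
  then have "card S \<le> card (R \<union> uminus ` R)"
    using fin by (intro card_mono) auto
  moreover have "card (R \<union> uminus ` R) + card (R \<inter> uminus ` R) = card R + card R"
    using fin card_Un_Int[of R "uminus ` R"] by (simp add: card_image)
  moreover have "card {v0, - v0} \<le> card (R \<inter> uminus ` R)"
    using fin assms by (intro card_mono) force+
  moreover have "card {v0, - v0} = 2"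
    using \<open>v0 \<noteq> 0\<close> by (auto simp: eq_uminus_iff_eq_0 card_insert_if)
  ultimately show ?thesis
    using assms(3) by linarith
qed

text \<open>If \<open>v\<close> combines \<open>P\<close> with a point of the hull of
  \<open>X\<close> of weight \<open>t\<close>, then \<open>f v <= t * f v\<close>, as
  \<open>f\<close> vanishes at \<open>P\<close>. Positivity of \<open>f v\<close> forces
  \<open>t = 1\<close>, so \<open>v\<close> was in the hull of \<open>X\<close> already.\<close>

lemma not_mem_hull_insert_if_max:
  fixes f :: "'a::real_vector \<Rightarrow> real"
  assumes "linear f" "f P = 0" "0 < f v" "\<And>x. x \<in> X \<Longrightarrow> f x \<le> f v"
    and "X \<noteq> {}" "v \<notin> convex hull X"
  shows "v \<notin> convex hull (insert P X)"
proof
  assume "v \<in> convex hull (insert P X)"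
  then obtain s t y where st: "0 \<le> s" "0 \<le> t" "s + t = 1" "y \<in> convex hull X"
    and v: "v = s *\<^sub>R P + t *\<^sub>R y"
    using assms(5) by (auto simp: convex_hull_insert)
  have "convex {x. f x \<le> f v}"
    using convex_linear_vimage[OF assms(1), of "{..f v}"] by (simp add: vimage_def)
  then have "convex hull X \<subseteq> {x. f x \<le> f v}"
    using assms(4) by (intro hull_minimal) auto
  then have "f y \<le> f v"
    using st by auto
  have "f v = t * f y"
    using assms(1,2) by (subst v) (simp add: linear_add linear_scale)
  also have "\<dots> \<le> t * f v"
    using \<open>f y \<le> f v\<close> st by (intro mult_left_mono) auto
  finally have "1 \<le> t"
    using \<open>0 < f v\<close> by simp
  with st have "s = 0" "t = 1" by auto
  with st v assms(6) show False by simp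
qed

lemma convex_position_insertI:
  assumes "P \<notin> convex hull R" "\<And>v. v \<in> R \<Longrightarrow> v \<notin> convex hull (insert P (R - {v}))"
  shows "convex_position (insert P R)"
proof -
  have "P \<notin> R"
    using assms(1) hull_subset by force
  then have "insert P R - {P} = R" and "\<And>v. v \<in> R \<Longrightarrow> insert P R - {v} = insert P (R - {v})"
    by auto
  then show ?thesis
    using assms unfolding convex_position_def by auto
qed

lemma convex_position_subset:
  assumes "convex_position T" "U \<subseteq> T"
  shows "convex_position U"
  using assms hull_mono[of "U - {_}" "T - {_}" convex] unfolding convex_position_def
  by (meson Diff_mono order_refl subset_iff)

lemma antipodal_circle_extension:
  assumes "finite S" and unit: "\<And>v. v \<in> S \<Longrightarrow> norm v = 1"
    and anti: "\<And>v. v \<in> S \<Longrightarrow> - v \<in> S"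
    and "card S = 2 * k" "S \<noteq> {}" "P \<notin> S"
    and gp: "general_position (S \<union> {P})"
  obtains R where "R \<subseteq> S" "k + 1 \<le> card R" "convex_position (insert P R)"
proof -
  \<comment> \<open>The line through \<open>v\<close> and \<open>- v\<close> passes through the
    centre, and general position keeps \<open>P\<close> off it.\<close>
  have cross_nz: "cross2 v P \<noteq> 0" if "v \<in> S" for v
  proof -
    have "v \<noteq> - v"
      using unit[OF that] by (auto simp: eq_uminus_iff_eq_0)
    then have "orient v (- v) P \<noteq> 0"
      using gp[unfolded general_position_iff, rule_format, of v "- v" P] that anti[OF that] \<open>P \<notin> S\<close>
      by auto
    moreover have "orient v (- v) P = - 2 * cross2 v P"
      by (simp add: orient_def cross2_def algebra_simps)
    ultimately show ?thesis by simp
  qed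
  show ?thesis
  proof (cases "norm P \<le> 1")
    case True
    obtain v0 where v0: "v0 \<in> S"
      using \<open>S \<noteq> {}\<close> by blast
    \<comment> \<open>The factor \<open>c\<close> normalises the side: \<open>P\<close> gets the
      positive value \<open>c * c\<close>, while \<open>v0\<close> and \<open>- v0\<close> get
      \<open>0\<close> and so both belong to \<open>R\<close>.\<close>
    define c where "c = cross2 v0 P"
    define R where "R = {x \<in> S. c * cross2 v0 x \<le> 0}"
    have neg: "cross2 v0 (- x) = - cross2 v0 x" for x
      by (simp add: cross2_def)
    have "k + 1 \<le> card R"
    proof (rule card_gt_half_if_meets_antipodal_pairs)
      show "v \<in> R \<or> - v \<in> R" if "v \<in> S" for v
        using that anti by (auto simp: R_def neg)
      show "v0 \<in> R" "- v0 \<in> R" "v0 \<noteq> 0"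
        using v0 anti unit[OF v0] by (auto simp: R_def neg) (simp_all add: cross2_def)
    qed (use assms in \<open>auto simp: R_def\<close>)
    moreover have "convex_position (insert P R)"
    proof (rule convex_position_insertI)
      have "convex {x. c * cross2 v0 x \<le> 0}"
        using convex_linear_vimage[of "\<lambda>x. c * cross2 v0 x" "{..0}"]
          linear_compose_scale_right[OF linear_cross2, of c v0] by (simp add: vimage_def)
      then have "convex hull R \<subseteq> {x. c * cross2 v0 x \<le> 0}"
        by (intro hull_minimal) (auto simp: R_def)
      moreover have "0 < c * cross2 v0 P"
        using cross_nz[OF v0] by (auto simp: c_def zero_less_mult_iff neq_iff)
      ultimately show "P \<notin> convex hull R" by auto
    next
      fix v assume v: "v \<in> R"
      then have "v \<in> S" by (simp add: R_def)
      \<comment> \<open>The tangent at \<open>v\<close> separates it from the other points of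
        \<open>R\<close> and from \<open>P\<close>, which lies in the closed disc and differs from
        \<open>v\<close>.\<close>
      show "v \<notin> convex hull (insert P (R - {v}))"
      proof (rule not_mem_hull_if_strict_support)
        show "v \<bullet> x < 1" if "x \<in> insert P (R - {v})" for x
          using that True unit \<open>v \<in> S\<close> \<open>P \<notin> S\<close>
          by (intro inner_unit_less_1) (auto simp: R_def)
        show "1 \<le> v \<bullet> v"
          using unit[OF \<open>v \<in> S\<close>] by (simp add: norm_eq_1)
      qed
    qed
    ultimately show ?thesis
      using that[of R] by (auto simp: R_def)
  next
    case False
    define R where "R = {v \<in> S. v \<notin> convex hull (insert P (S - {v}))}"
    \<comment> \<open>If \<open>P\<close> were strictly below the tangent at \<open>v\<close>, that
      tangent would keep \<open>v\<close> extreme. The conclusion cannot hold for both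
      \<open>v\<close> and \<open>- v\<close>, so each pair loses at most one point.\<close>
    have lost: "1 \<le> v \<bullet> P" if "v \<in> S" "v \<notin> R" for v
    proof (rule ccontr)
      assume less: "\<not> 1 \<le> v \<bullet> P"
      have "v \<notin> convex hull (insert P (S - {v}))"
      proof (rule not_mem_hull_if_strict_support)
        show "v \<bullet> x < 1" if "x \<in> insert P (S - {v})" for x
          using that less unit \<open>v \<in> S\<close> inner_unit_less_1[of v x] by (cases "x = P") auto
        show "1 \<le> v \<bullet> v"
          using unit[OF \<open>v \<in> S\<close>] by (simp add: norm_eq_1)
      qed
      with that show False by (simp add: R_def)
    qed
    have neg: "cross2 P (- x) = - cross2 P x" for x
      by (simp add: cross2_def)
    have swap: "cross2 P x = - cross2 x P" for x
      by (simp add: cross2_def)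
    \<comment> \<open>Up to the factor \<open>norm P\<close>, the map \<open>cross2 P\<close> is the
      signed distance from the line through the centre and \<open>P\<close>. By symmetry its
      negative is maximal at \<open>- w\<close>.\<close>
    obtain w where w: "w \<in> S" "\<And>x. x \<in> S \<Longrightarrow> cross2 P x \<le> cross2 P w"
    proof -
      have "Max (cross2 P ` S) \<in> cross2 P ` S"
        using assms(1,5) by (intro Max_in) auto
      then obtain w where "w \<in> S" "cross2 P w = Max (cross2 P ` S)"
        by auto
      with that[of w] assms(1) show ?thesis by simp
    qed
    \<comment> \<open>Comparison with \<open>- w\<close> makes the maximum nonnegative, and
      \<open>cross_nz\<close> excludes zero.\<close>
    have pos: "0 < cross2 P w"
      using w(2)[OF anti[OF w(1)]] cross_nz[OF w(1)] swap[of w] neg[of w] by linarith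
    have keep: "v \<in> R" if "v \<in> S" "linear f" "f P = 0" "0 < f v" "\<And>x. x \<in> S \<Longrightarrow> f x \<le> f v"
      for v and f :: "real ^ 2 \<Rightarrow> real"
    proof -
      have "v \<noteq> - v"
        using unit[OF that(1)] by (auto simp: eq_uminus_iff_eq_0)
      then have "S - {v} \<noteq> {}"
        using anti[OF that(1)] by auto
      moreover have "v \<notin> convex hull (S - {v})"
        using unit that(1) by (intro unit_not_mem_hull) auto
      ultimately show ?thesis
        using not_mem_hull_insert_if_max[of f P v "S - {v}"] that by (auto simp: R_def)
    qed
    have "w \<in> R"
      using w pos by (intro keep[of _ "cross2 P"] linear_cross2) (simp_all add: cross2_def)
    moreover have "- w \<in> R"
    proof (rule keep[of _ "\<lambda>x. - cross2 P x"])
      show "- cross2 P x \<le> - cross2 P (- w)" if "x \<in> S" for x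
        using w(2)[OF anti[OF that]] by (simp add: neg)
    qed (use w anti pos in \<open>auto simp: neg linear_compose_neg linear_cross2, simp add: cross2_def\<close>)
    moreover have "v \<in> R \<or> - v \<in> R" if "v \<in> S" for v
      using lost[OF that] lost[OF anti[OF that]] by force
    moreover have "w \<noteq> 0"
      using unit[OF w(1)] by auto
    ultimately have "k + 1 \<le> card R"
      using assms by (intro card_gt_half_if_meets_antipodal_pairs[of S R]) (auto simp: R_def)
    moreover have "convex_position (insert P R)"
    proof (rule convex_position_insertI)
      have "convex hull R \<subseteq> cball 0 1"
        using unit by (intro hull_minimal) (auto simp: R_def)
      then show "P \<notin> convex hull R"
        using False by auto
      show "v \<notin> convex hull (insert P (R - {v}))" if "v \<in> R" for v
        using that hull_mono[of "insert P (R - {v})" "insert P (S - {v})" convex]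
        by (auto simp: R_def)
    qed
    ultimately show ?thesis
      using that[of R] by (auto simp: R_def)
  qed
qed

section \<open>The saturated configuration and the exact value\<close>

lemma infinite_upper_half_circle: "infinite {v :: real ^ 2. norm v = 1 \<and> 0 < v $ 2}"
proof
  define g :: "real \<Rightarrow> real ^ 2" where "g t = vector [t, sqrt (1 - t\<^sup>2)]" for t
  assume fin: "finite {v :: real ^ 2. norm v = 1 \<and> 0 < v $ 2}"
  have "g ` {0<..<1} \<subseteq> {v. norm v = 1 \<and> 0 < v $ 2}"
    by (auto simp: g_def norm_eq_1 inner_vec_def sum_2 vector_2 power_less_one_iff
        abs_square_le_1 abs_square_less_1 simp flip: power2_eq_square)
  with fin have "finite (g ` {0<..<1})"
    using finite_subset by blast
  moreover have "inj_on g {0<..<1}"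
    by (rule inj_onI) (simp add: g_def vec_eq_iff forall_2 vector_2)
  ultimately have "finite {0<..<1::real}"
    by (rule finite_imageD)
  then show False
    by (simp add: infinite_Ioo)
qed

lemma osaturated_antipodal_exists:
  assumes "n \<ge> 3"
  obtains S where "osaturated n S" "card S = 2 * n - 4"
proof -
  obtain A where A: "A \<subseteq> {v :: real ^ 2. norm v = 1 \<and> 0 < v $ 2}" "finite A" "card A = n - 2"
    using infinite_arbitrarily_large[OF infinite_upper_half_circle] by blast
  \<comment> \<open>Points of \<open>A\<close> have positive second coordinate, so no two of them
    are antipodal and \<open>S\<close> consists of exactly \<open>n - 2\<close> pairs.\<close>
  define S where "S = A \<union> uminus ` A"
  have "A \<inter> uminus ` A = {}"
  proof -
    have "- v \<notin> A" if "v \<in> A" for v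
      using subsetD[OF A(1) that] subsetD[OF A(1), of "- v"] by auto
    then show ?thesis by blast
  qed
  then have card: "card S = 2 * (n - 2)"
    using A by (simp add: S_def card_Un_disjoint card_image)
  have fin: "finite S"
    using A by (simp add: S_def)
  have unit: "norm v = 1" if "v \<in> S" for v
    using that A(1) by (auto simp: S_def)
  have anti: "- v \<in> S" if "v \<in> S" for v
    using that by (auto simp: S_def)
  have "S \<noteq> {}"
    using card assms by auto
  have "osaturated n S"
    unfolding osaturated_def
  proof (intro conjI allI impI fin)
    show "general_position S"
      using unit by (rule general_position_unit_circle)
    fix P assume P: "P \<notin> S \<and> general_position (S \<union> {P})"
    then obtain R where R: "R \<subseteq> S" "n - 2 + 1 \<le> card R" "convex_position (insert P R)"
      using antipodal_circle_extension[OF fin unit anti card \<open>S \<noteq> {}\<close>] by metis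
    \<comment> \<open>The set \<open>R\<close> may be too large. Convex position passes to subsets,
      so \<open>n - 1\<close> of its points suffice, and \<open>P\<close> is the
      \<open>n\<close>-th.\<close>
    obtain Q where Q: "Q \<subseteq> R" "card Q = n - 2 + 1" "finite Q"
      using R(2) by (meson obtain_subset_with_card_n)
    have "convex_nset n (insert P Q)"
      using Q R P assms convex_position_subset[OF R(3), of "insert P Q"]
      by (auto simp: convex_nset_def card_insert_if)
    then show "\<exists>T\<subseteq>S \<union> {P}. P \<in> T \<and> convex_nset n T"
      using Q R by (intro exI[of _ "insert P Q"]) auto
  qed
  with card show ?thesis
    by (intro that[of S]) auto
qed

theorem theorem8:
  fixes n :: nat
  assumes "n \<ge> 3"
  shows "osat n = 2 * n - 4"
proof -
  obtain S where "osaturated n S" "card S = 2 * n - 4"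
    using osaturated_antipodal_exists[OF assms] .
  \<comment> \<open>The lower bound is attained by \<open>S\<close>, so the infimum is a genuine
    minimum and not the default value for the empty set.\<close>
  then show ?thesis
    unfolding osat_def by (intro cInf_eq_minimum) (use osaturated_card_ge in force)+
qed

end
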